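(* There are universal constants $c_1,c_2>0$ such that for every real $0<\varepsilon<1$ and every finite set $X\subset\mathbb{R}^2$ of diameter at most $1$ with $|X|\ge c_1\varepsilon^{-2}$, $$|\mathcal{N}_{\varepsilon}(X)|\ \ge\ c_2\,\varepsilon^{1/2}\,|\mathcal{A}_{\varepsilon}(X)|.$$
   Context: For a finite set $X\subset\mathbb{R}^2$ and $0<\varepsilon<1$, with $\|\cdot\|$ the Euclidean norm, $\mathcal{A}_\varepsilon(X)$ is the set of unordered pairs $\{x,y\}\subset X$ of distinct points with $\|x-y\|\ge 1-\varepsilon$ ($\varepsilon$-antipodal pairs), and $\mathcal{N}_\varepsilon(X)$ is the set of unordered pairs $\{x,y\}\subset X$ of distinct points with $\|x-y\|\le\varepsilon$ ($\varepsilon$-neighboring pairs). *)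

theory Defs
  imports "HOL-Analysis.Analysis"
begin

definition antipodal_pairs :: "real \<Rightarrow> (real^2) set \<Rightarrow> (real^2) set set" where
  "antipodal_pairs \<epsilon> X =
     {{x, y} | x y. x \<in> X \<and> y \<in> X \<and> x \<noteq> y \<and> norm (x - y) \<ge> 1 - \<epsilon>}"

definition neighboring_pairs :: "real \<Rightarrow> (real^2) set \<Rightarrow> (real^2) set set" where
  "neighboring_pairs \<epsilon> X =
     {{x, y} | x y. x \<in> X \<and> y \<in> X \<and> x \<noteq> y \<and> norm (x - y) \<le> \<epsilon>}"

end

theory Submission
  imports Defs
begin

text \<open>
  Replace \<open>X\<close> by an \<open>\<epsilon>/2\<close>-separated net \<open>Y\<close>, weighting each \<open>u \<in> Y\<close> by the
  number \<open>w u\<close> of points of \<open>X\<close> assigned to it. Points assigned to the same \<open>u\<close> are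
  \<open>\<epsilon>\<close>-neighbours, so \<open>\<Sum>u. (w u)\<^sup>2\<close> is at most \<open>|X| + 2 |N|\<close>; and since the net has
  only \<open>O(\<epsilon>\<^sup>-\<^sup>2)\<close> points, Cauchy--Schwarz shows that the term \<open>|X|\<close> is harmless once
  \<open>|X| \<ge> c1 \<epsilon>\<^sup>-\<^sup>2\<close>. An \<open>\<epsilon>\<close>-antipodal pair of \<open>X\<close> projects to an edge of the graph \<open>G\<close> on
  \<open>Y\<close> that joins points at distance at least \<open>1 - 2 \<epsilon>\<close>. Hence everything reduces to the
  spectral estimate \<open>\<Sum>_{u ~ v} w u * w v \<le> C \<epsilon>\<^sup>-\<^sup>1\<^sup>/\<^sup>2 \<Sum>u. (w u)\<^sup>2\<close>
  (\<open>near_unit_graph_form_le\<close>). For \<open>\<epsilon>\<close> bounded away from \<open>0\<close> it is enough to use that the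
  net has boundedly many points.

  Degrees in \<open>G\<close> can be as large as \<open>1/\<epsilon>\<close>, even at both ends of an edge (two vertices of a
  Reuleaux triangle), so neither the maximal degree nor the maximum of
  \<open>sqrt (deg u * deg v)\<close> over the edges gives this estimate. The Schur test with
  weights \<open>sqrt (deg u)\<close> does, and it asks for
  \<open>\<Sum>_{v ~ u} sqrt (deg v) \<le> C \<epsilon>\<^sup>-\<^sup>1\<^sup>/\<^sup>2 sqrt (deg u)\<close> (\<open>sum_sqrt_degree_le\<close>). The geometric
  reason is a robust form of the fact that any two diameters of a planar set cross
  (\<open>almost_crossing\<close>): let \<open>v\<close> be a neighbour of \<open>u\<close> such that \<open>u\<close> has neighbours at an
  angle of at least \<open>\<alpha>\<close> on either side of \<open>v\<close>; then all neighbours of \<open>v\<close> lie within an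
  angle \<open>O(\<epsilon>/\<alpha>)\<close> of \<open>u\<close>, so that \<open>deg v = O(1/\<alpha>)\<close> (\<open>degree_le_interior\<close>). The
  neighbours of \<open>u\<close> lie in a thin annulus and are separated, so the one that is \<open>k\<close>-th from
  the nearer end of the angular order has \<open>\<alpha> + \<epsilon>\<close> of order \<open>k \<epsilon>\<close> at least (\<open>level_card\<close>), and
  therefore degree \<open>O(1/(k \<epsilon>))\<close>. The sum over \<open>k \<le> deg u\<close> of \<open>1 / sqrt (k \<epsilon>)\<close> is of
  order \<open>\<epsilon>\<^sup>-\<^sup>1\<^sup>/\<^sup>2 sqrt (deg u)\<close>, as required.

  Angles never appear: the cross product of two nearly unit vectors stands in for the
  angle between them.
\<close>

section \<open>Plane vectors of nearly unit length\<close>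

definition cross2 :: "real^2 \<Rightarrow> real^2 \<Rightarrow> real" where
  "cross2 v p = v $ 1 * p $ 2 - v $ 2 * p $ 1"

lemma inner2: "(v::real^2) \<bullet> p = v $ 1 * p $ 1 + v $ 2 * p $ 2"
  by (simp add: inner_vec_def sum_2)

lemma lagrange_mixed:
  "(norm v)\<^sup>2 * (r \<bullet> p) = (v \<bullet> r) * (v \<bullet> p) + cross2 v r * cross2 v p"
  by (simp add: power2_norm_eq_inner inner2 cross2_def algebra_simps)

lemma lagrange: "(v \<bullet> p)\<^sup>2 + (cross2 v p)\<^sup>2 = (norm v)\<^sup>2 * (norm p)\<^sup>2"
  using lagrange_mixed[of v p p] by (simp add: dot_square_norm power2_eq_square)

lemma cross2_diff: "cross2 v (p - q) = cross2 v p - cross2 v q"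
  by (simp add: cross2_def algebra_simps)

lemma cross2_swap: "cross2 p v = - cross2 v p"
  by (simp add: cross2_def)

lemma cross2_minus [simp]: "cross2 (- v) p = - cross2 v p"
  by (simp add: cross2_def)

lemma abs_cross2_le_1:
  assumes "norm v \<le> 1" "norm p \<le> 1"
  shows "\<bar>cross2 v p\<bar> \<le> 1"
proof -
  have "(cross2 v p)\<^sup>2 \<le> (norm v)\<^sup>2 * (norm p)\<^sup>2"
    using lagrange[of v p] by (smt (verit) zero_le_power2)
  also have "\<dots> \<le> 1"
    using assms by (simp add: mult_le_one power_le_one)
  finally show ?thesis by (simp add: abs_square_le_1)
qed

lemma sq_norm_lower:
  assumes "1 - \<delta> \<le> norm (v :: 'a :: real_normed_vector)"
  shows "1 - 2 * \<delta> \<le> (norm v)\<^sup>2"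
proof -
  have "0 \<le> (1 - norm v)\<^sup>2" by simp
  then have "2 * norm v - 1 \<le> (norm v)\<^sup>2" by (simp add: power2_eq_square algebra_simps)
  with assms show ?thesis by linarith
qed

text \<open>
  Take \<open>u = 0\<close>. Here \<open>v\<close> and \<open>p\<close> are neighbours of \<open>u\<close>, and \<open>v + r\<close> is a neighbour of \<open>v\<close>.
  If all three vectors had length exactly \<open>1\<close>, expanding \<open>norm (v + r - p) \<le> 1\<close> would give
  \<open>cross2 v r * cross2 v p \<ge> (1 + v \<bullet> r) * (1 - v \<bullet> p) \<ge> 0\<close>, that is, the segments from
  \<open>u\<close> to \<open>p\<close> and from \<open>v\<close> to \<open>v + r\<close> leave the line \<open>uv\<close> on the same side. Lengths that are
  off by \<open>\<delta>\<close> only perturb this by \<open>O(\<delta>)\<close>.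
\<close>

lemma almost_crossing:
  assumes "1 - \<delta> \<le> norm v" "norm v \<le> 1" "1 - \<delta> \<le> norm r" "norm r \<le> 1"
    and "1 - \<delta> \<le> norm p" "norm p \<le> 1" and "norm (v + r - p) \<le> 1"
  shows "- 9 * \<delta> \<le> cross2 v r * cross2 v p"
proof -
  define A where "A = v \<bullet> r"
  define B where "B = v \<bullet> p"
  define n where "n = (norm v)\<^sup>2"
  have nb: "1 - 2 * \<delta> \<le> n" "n \<le> 1" "0 \<le> n"
    using assms sq_norm_lower[of \<delta> v] by (auto simp: n_def power_le_one)
  have AB: "\<bar>A\<bar> \<le> 1" "\<bar>B\<bar> \<le> 1"
    using Cauchy_Schwarz_ineq2[of v r] Cauchy_Schwarz_ineq2[of v p] assms
    unfolding A_def B_def by (meson mult_le_one norm_ge_zero order_trans)+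
  have "(norm (v + r - p))\<^sup>2 \<le> 1" using assms by (simp add: power_le_one)
  moreover have "(norm (v + r - p))\<^sup>2
      = (norm v)\<^sup>2 + (norm r)\<^sup>2 + (norm p)\<^sup>2 + 2 * A - 2 * B - 2 * (r \<bullet> p)"
    by (simp add: power2_norm_eq_inner A_def B_def inner_simps inner_commute)
  ultimately have rp: "1 + A - B - 3 * \<delta> \<le> r \<bullet> p"
    using sq_norm_lower[of \<delta> v] sq_norm_lower[of \<delta> r] sq_norm_lower[of \<delta> p] assms by linarith
  have "cross2 v r * cross2 v p = n * (r \<bullet> p) - A * B"
    using lagrange_mixed[of v r p] by (simp add: A_def B_def n_def)
  also have "\<dots> \<ge> n * (1 + A - B - 3 * \<delta>) - A * B"
    using rp nb by (simp add: mult_left_mono)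
  also have "n * (1 + A - B - 3 * \<delta>) - A * B
      = (1 + A) * (1 - B) - 3 * \<delta> * n - (1 - n) * (1 + A - B)"
    by (simp add: algebra_simps)
  moreover have "0 \<le> (1 + A) * (1 - B)" using AB by simp
  moreover have "(1 - n) * (1 + A - B) \<le> (1 - n) * 3"
    using nb AB by (intro mult_left_mono) auto
  moreover have "3 * \<delta> * n \<le> 3 * \<delta> * 1"
    using nb by (intro mult_left_mono) auto
  ultimately have "- (3 * \<delta>) - (1 - n) * 3 \<le> cross2 v r * cross2 v p" by linarith
  then show ?thesis using nb by (simp add: algebra_simps)
qed

text \<open>
  Relative to a vector \<open>b\<close> of nearly unit length, a vector \<open>r\<close> in the half-plane of \<open>b\<close> and
  well away from the line orthogonal to \<open>b\<close> is determined, up to a constant factor in the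
  error, by its length and by \<open>cross2 b r\<close>: these two give \<open>(b \<bullet> r)\<^sup>2\<close>, and \<open>b \<bullet> r\<close> is
  bounded below.
\<close>

lemma level_separation:
  assumes h: "0 < h" and b: "9/10 \<le> norm b" "norm b \<le> 1"
    and r: "norm r \<le> 1" "2/5 \<le> b \<bullet> r" and s: "norm s \<le> 1" "2/5 \<le> b \<bullet> s"
    and c: "\<bar>cross2 b r - cross2 b s\<bar> \<le> h" and n: "\<bar>norm r - norm s\<bar> \<le> h"
  shows "norm (r - s) < 8 * h"
proof -
  define x where "x = b \<bullet> r"
  define x' where "x' = b \<bullet> s"
  define y where "y = cross2 b r"
  define y' where "y' = cross2 b s"
  have sqd: "\<bar>p\<^sup>2 - q\<^sup>2\<bar> \<le> 2 * h" if "\<bar>p\<bar> \<le> 1" "\<bar>q\<bar> \<le> 1" "\<bar>p - q\<bar> \<le> h" for p q :: real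
  proof -
    have "\<bar>p\<^sup>2 - q\<^sup>2\<bar> = \<bar>p + q\<bar> * \<bar>p - q\<bar>"
      by (simp add: power2_eq_square abs_mult[symmetric] algebra_simps)
    also have "\<dots> \<le> 2 * h" using that by (intro mult_mono) auto
    finally show ?thesis .
  qed
  have yy: "\<bar>y\<^sup>2 - y'\<^sup>2\<bar> \<le> 2 * h"
    using abs_cross2_le_1 b r s c by (intro sqd) (auto simp: y_def y'_def)
  have nn: "\<bar>(norm r)\<^sup>2 - (norm s)\<^sup>2\<bar> \<le> 2 * h"
    using r s n by (intro sqd) auto
  have "x\<^sup>2 - x'\<^sup>2 = (norm b)\<^sup>2 * ((norm r)\<^sup>2 - (norm s)\<^sup>2) - (y\<^sup>2 - y'\<^sup>2)"
    using lagrange[of b r] lagrange[of b s]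
    by (simp add: x_def x'_def y_def y'_def algebra_simps)
  moreover have "\<bar>(norm b)\<^sup>2 * ((norm r)\<^sup>2 - (norm s)\<^sup>2)\<bar> \<le> 1 * (2 * h)"
    unfolding abs_mult using b nn by (intro mult_mono) (auto simp: power_le_one)
  ultimately have xx: "\<bar>x\<^sup>2 - x'\<^sup>2\<bar> \<le> 4 * h" using yy by linarith
  have "4/5 * \<bar>x - x'\<bar> \<le> \<bar>x + x'\<bar> * \<bar>x - x'\<bar>"
    using r s by (intro mult_right_mono) (auto simp: x_def x'_def)
  also have "\<dots> = \<bar>x\<^sup>2 - x'\<^sup>2\<bar>"
    by (simp add: power2_eq_square abs_mult[symmetric] algebra_simps)
  also note xx
  finally have dx: "\<bar>x - x'\<bar> \<le> 5 * h" by simp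
  have "(norm b)\<^sup>2 * (norm (r - s))\<^sup>2 = (x - x')\<^sup>2 + (y - y')\<^sup>2"
    using lagrange[of b "r - s"]
    by (simp add: x_def x'_def y_def y'_def cross2_diff inner_diff_right)
  also have "\<dots> \<le> (5 * h)\<^sup>2 + h\<^sup>2"
    using dx c h by (intro add_mono abs_le_square_iff[THEN iffD1]) (simp_all add: y_def y'_def)
  also have "\<dots> = 26 * h\<^sup>2" by (simp add: power2_eq_square)
  finally have "(norm b)\<^sup>2 * (norm (r - s))\<^sup>2 \<le> 26 * h\<^sup>2" .
  moreover have "(9/10)\<^sup>2 * (norm (r - s))\<^sup>2 \<le> (norm b)\<^sup>2 * (norm (r - s))\<^sup>2"
    using b by (intro mult_right_mono power_mono) auto
  ultimately have "81/100 * (norm (r - s))\<^sup>2 \<le> 26 * h\<^sup>2"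
    by (simp add: power2_eq_square)
  moreover have "0 < h\<^sup>2" using h by simp
  ultimately have "(norm (r - s))\<^sup>2 < 64 * h\<^sup>2" by linarith
  then have "(norm (r - s))\<^sup>2 < (8 * h)\<^sup>2" by (simp add: power_mult_distrib)
  then show ?thesis by (rule power2_less_imp_less) (use h in simp)
qed

section \<open>Counting, and the Schur test\<close>

lemma floor_eq_imp_close:
  assumes "0 < h" "\<lfloor>x / h\<rfloor> = \<lfloor>y / h\<rfloor>"
  shows "\<bar>x - y\<bar> < (h::real)"
proof -
  have "\<bar>x / h - y / h\<bar> < 1" using assms(2) by linarith
  then have "\<bar>(x - y) / h\<bar> < 1" by (simp add: diff_divide_distrib)
  then show ?thesis using assms(1) by (simp add: abs_divide)
qed

lemma card_floor_range:
  fixes f :: "'a \<Rightarrow> real"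
  assumes "finite S" "0 < h" "lo \<le> hi" "\<And>x. x \<in> S \<Longrightarrow> lo \<le> f x \<and> f x \<le> hi"
  shows "real (card ((\<lambda>x. \<lfloor>f x / h\<rfloor>) ` S)) \<le> (hi - lo) / h + 2"
proof -
  have "(\<lambda>x. \<lfloor>f x / h\<rfloor>) ` S \<subseteq> {\<lfloor>lo / h\<rfloor>..\<lfloor>hi / h\<rfloor>}"
    using assms by (auto intro!: floor_mono divide_right_mono)
  then have "card ((\<lambda>x. \<lfloor>f x / h\<rfloor>) ` S) \<le> card {\<lfloor>lo / h\<rfloor>..\<lfloor>hi / h\<rfloor>}"
    by (intro card_mono) auto
  moreover have "lo / h \<le> hi / h" using assms by (simp add: divide_right_mono)
  then have "real (card {\<lfloor>lo / h\<rfloor>..\<lfloor>hi / h\<rfloor>}) \<le> hi / h - lo / h + 2"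
    by simp linarith
  ultimately show ?thesis by (simp add: diff_divide_distrib)
qed

lemma sum_inverse_sqrt_le: "(\<Sum>k<n. 1 / sqrt (real (Suc k))) \<le> 2 * sqrt (real n)"
proof (induction n)
  case (Suc n)
  define a where "a = sqrt (real n)"
  define b where "b = sqrt (real (Suc n))"
  have ab: "0 \<le> a" "a \<le> b" "0 < b" "b * b - a * a = 1"
    by (simp_all add: a_def b_def)
  have "1 = (b + a) * (b - a)" using ab by (simp add: algebra_simps)
  also have "\<dots> \<le> (2 * b) * (b - a)" using ab by (intro mult_right_mono) auto
  finally have "1 / b \<le> 2 * (b - a)" using ab by (simp add: divide_le_eq mult.commute mult.left_commute)
  with Suc show ?case by (simp add: a_def b_def)
qed simp

text \<open>
  The sum is largest when \<open>k\<close> takes the smallest values allowed, each about \<open>K\<close> times. Terms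
  with \<open>k v < card S\<close> are grouped by value; each of the others is at most
  \<open>1 / sqrt (card S)\<close>.
\<close>

lemma sum_inverse_sqrt_fibres:
  fixes k :: "'a \<Rightarrow> nat"
  assumes "finite S" and fib: "\<And>m. real (card {v \<in> S. k v = m}) \<le> K"
  shows "(\<Sum>v\<in>S. 1 / sqrt (real (Suc (k v)))) \<le> (2 * K + 1) * sqrt (real (card S))"
proof -
  define D where "D = card S"
  define g where "g m = 1 / sqrt (real (Suc m))" for m
  have K: "0 \<le> K" using fib[of 0] by (smt (verit) of_nat_0_le_iff)
  have "(\<Sum>v\<in>{v\<in>S. k v < D}. g (k v)) = (\<Sum>m<D. \<Sum>v\<in>{v\<in>{v\<in>S. k v < D}. k v = m}. g (k v))"
    using assms by (intro sum.group[symmetric]) auto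
  also have "\<dots> = (\<Sum>m<D. real (card {v\<in>S. k v = m}) * g m)"
  proof (intro sum.cong refl)
    fix m assume "m \<in> {..<D}"
    then have "{v\<in>{v\<in>S. k v < D}. k v = m} = {v\<in>S. k v = m}" by auto
    then show "(\<Sum>v\<in>{v\<in>{v\<in>S. k v < D}. k v = m}. g (k v)) = real (card {v\<in>S. k v = m}) * g m"
      by simp
  qed
  also have "\<dots> \<le> (\<Sum>m<D. K * g m)"
    using fib by (intro sum_mono mult_right_mono) (auto simp: g_def)
  also have "\<dots> \<le> K * (2 * sqrt (real D))"
    unfolding sum_distrib_left[symmetric] g_def using K sum_inverse_sqrt_le
    by (intro mult_left_mono) auto
  finally have 1: "(\<Sum>v\<in>{v\<in>S. k v < D}. g (k v)) \<le> K * (2 * sqrt (real D))" .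
  have "(\<Sum>v\<in>{v\<in>S. D \<le> k v}. g (k v)) \<le> (\<Sum>v\<in>S. 1 / sqrt (real D))"
  proof (rule sum_le_included[where i = id])
    show "\<forall>x\<in>{v \<in> S. D \<le> k v}. \<exists>y\<in>S. id y = x \<and> g (k x) \<le> 1 / sqrt (real D)"
    proof
      fix x assume x: "x \<in> {v \<in> S. D \<le> k v}"
      then have "0 < D" using assms(1) by (auto simp: D_def card_gt_0_iff)
      with x have "g (k x) \<le> 1 / sqrt (real D)"
        by (auto simp: g_def intro!: divide_left_mono)
      with x show "\<exists>y\<in>S. id y = x \<and> g (k x) \<le> 1 / sqrt (real D)" by auto
    qed
  qed (use assms in auto)
  also have "\<dots> = sqrt (real D)" by (simp add: D_def real_div_sqrt)
  finally have 2: "(\<Sum>v\<in>{v\<in>S. D \<le> k v}. g (k v)) \<le> sqrt (real D)" .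
  have "(\<Sum>v\<in>S. g (k v)) = (\<Sum>v\<in>{v\<in>S. k v < D}. g (k v)) + (\<Sum>v\<in>{v\<in>S. D \<le> k v}. g (k v))"
    using assms by (subst sum.union_disjoint[symmetric]) (auto intro!: sum.cong)
  with 1 2 show ?thesis by (simp add: g_def D_def algebra_simps)
qed

text \<open>
  By the inequality of arithmetic and geometric means,
  \<open>2 * w u * w v \<le> (w u)\<^sup>2 * f v / f u + (w v)\<^sup>2 * f u / f v\<close>. By symmetry of \<open>R\<close> both halves
  have the same sum over all edges, and the row condition bounds it.
\<close>

lemma schur_test:
  fixes w f :: "'a \<Rightarrow> real"
  assumes fin: "finite Y" and sym: "\<And>u v. R u v \<Longrightarrow> R v u"
    and pos: "\<And>u v. u \<in> Y \<Longrightarrow> v \<in> Y \<Longrightarrow> R u v \<Longrightarrow> 0 < f u"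
    and row: "\<And>u. u \<in> Y \<Longrightarrow> (\<Sum>v | v \<in> Y \<and> R u v. f v) \<le> C * f u"
    and nn: "\<And>u. 0 \<le> f u" "0 \<le> C"
  shows "(\<Sum>u\<in>Y. \<Sum>v | v \<in> Y \<and> R u v. w u * w v) \<le> C * (\<Sum>u\<in>Y. (w u)\<^sup>2)"
proof -
  define a where "a u v = (w u)\<^sup>2 * (f v / f u)" for u v
  define N where "N u = {v. v \<in> Y \<and> R u v}" for u
  have finN: "finite (N u)" for u using fin by (auto simp: N_def)
  have swap: "(\<Sum>u\<in>Y. \<Sum>v\<in>N u. a v u) = (\<Sum>u\<in>Y. \<Sum>v\<in>N u. a u v)"
  proof -
    have "(\<Sum>u\<in>Y. \<Sum>v\<in>N u. a v u) = (\<Sum>v\<in>Y. \<Sum>u | u \<in> Y \<and> R u v. a v u)"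
      unfolding N_def by (rule sum.swap_restrict[OF fin fin])
    also have "\<dots> = (\<Sum>v\<in>Y. \<Sum>u\<in>N v. a v u)"
      unfolding N_def using sym by (intro sum.cong) auto
    finally show ?thesis .
  qed
  have "(\<Sum>u\<in>Y. \<Sum>v\<in>N u. w u * w v) \<le> (\<Sum>u\<in>Y. \<Sum>v\<in>N u. (a u v + a v u) / 2)"
  proof (intro sum_mono)
    fix u v assume uv: "u \<in> Y" "v \<in> N u"
    then have p: "0 < f u" "0 < f v" using pos sym by (auto simp: N_def)
    have "0 \<le> (w u * f v - w v * f u)\<^sup>2 / (f u * f v)" using p by simp
    also have "\<dots> = a u v + a v u - 2 * (w u * w v)"
      using p by (simp add: a_def field_simps power2_eq_square)
    finally show "w u * w v \<le> (a u v + a v u) / 2" by simp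
  qed
  also have "\<dots> = (\<Sum>u\<in>Y. \<Sum>v\<in>N u. a u v)"
    using swap by (simp add: sum_divide_distrib[symmetric] sum.distrib)
  also have "\<dots> \<le> (\<Sum>u\<in>Y. C * (w u)\<^sup>2)"
  proof (intro sum_mono)
    fix u assume u: "u \<in> Y"
    show "(\<Sum>v\<in>N u. a u v) \<le> C * (w u)\<^sup>2"
    proof (cases "N u = {}")
      case True then show ?thesis using nn by simp
    next
      case False
      then have p: "0 < f u" using pos u by (auto simp: N_def)
      have "(\<Sum>v\<in>N u. a u v) = (w u)\<^sup>2 * ((\<Sum>v\<in>N u. f v) / f u)"
        by (simp add: a_def sum_distrib_left sum_divide_distrib)
      also have "\<dots> \<le> (w u)\<^sup>2 * C"
        using row[OF u] p by (intro mult_left_mono) (auto simp: N_def divide_le_eq)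
      finally show ?thesis by (simp add: mult.commute)
    qed
  qed
  finally show ?thesis by (simp add: N_def sum_distrib_left)
qed


section \<open>The graph of nearly unit distances\<close>

text \<open>
  The scale \<open>h\<close> is chosen such that edges may be shorter than \<open>1\<close> by \<open>32 * h\<close>, whereas
  points of \<open>Y\<close> are \<open>8 * h\<close> apart, which is the resolution at which \<open>level_separation\<close>
  tells points apart. For a set \<open>X\<close> with parameter \<open>\<epsilon>\<close>, \<open>h = \<epsilon>/16\<close>: then \<open>8 * h = \<epsilon>/2\<close> and
  \<open>32 * h = 2 * \<epsilon>\<close>. The bound on \<open>h\<close> makes all edges longer than \<open>9/10\<close> and keeps the
  angle between two edges at a common vertex well below a right angle.
\<close>

locale near_unit_graph =
  fixes Y :: "(real^2) set" and h :: real
  assumes finite_Y: "finite Y" and h_pos: "0 < h" and h_small: "h \<le> 1/3200"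
    and diam: "x \<in> Y \<Longrightarrow> y \<in> Y \<Longrightarrow> norm (x - y) \<le> 1"
    and separated: "x \<in> Y \<Longrightarrow> y \<in> Y \<Longrightarrow> x \<noteq> y \<Longrightarrow> 8 * h \<le> norm (x - y)"
begin

definition nbrs :: "real^2 \<Rightarrow> (real^2) set" where
  "nbrs u = {v \<in> Y. 1 - 32 * h \<le> norm (v - u)}"

lemma finite_nbrs [simp]: "finite (nbrs u)"
  using finite_Y by (simp add: nbrs_def)

lemma nbrs_sym: "u \<in> Y \<Longrightarrow> v \<in> nbrs u \<Longrightarrow> u \<in> nbrs v"
  by (simp add: nbrs_def norm_minus_commute)

lemma nbrs_in_Y: "v \<in> nbrs u \<Longrightarrow> v \<in> Y"
  by (simp add: nbrs_def)

lemma nbrs_norm: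
  assumes "u \<in> Y" "v \<in> nbrs u"
  shows "1 - 32 * h \<le> norm (v - u)" "9/10 \<le> norm (v - u)" "norm (v - u) \<le> 1"
  using assms diam[of v u] h_small by (auto simp: nbrs_def)

lemma nbrs_dot:
  assumes "u \<in> Y" "v \<in> nbrs u" "p \<in> nbrs u"
  shows "2/5 \<le> (v - u) \<bullet> (p - u)"
proof -
  have "(norm ((v - u) - (p - u)))\<^sup>2 \<le> 1"
    using diam[of v p] assms by (simp add: nbrs_def power_le_one)
  moreover have "(norm ((v - u) - (p - u)))\<^sup>2
      = (norm (v - u))\<^sup>2 + (norm (p - u))\<^sup>2 - 2 * ((v - u) \<bullet> (p - u))"
    by (simp only: power2_norm_eq_inner inner_diff_left inner_diff_right)
      (simp add: inner_commute)
  ultimately show ?thesis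
    using sq_norm_lower[of "32 * h" "v - u"] sq_norm_lower[of "32 * h" "p - u"] assms h_small
    by (simp add: nbrs_def)
qed

text \<open>
  Within one level the distance to \<open>u\<close>, rounded to multiples of \<open>h\<close>, separates the points by
  \<open>level_separation\<close>, and as it lies in \<open>[1 - 32 * h, 1]\<close> it takes at most \<open>34\<close> values. With
  the sign \<open>\<sigma>\<close> the bound serves both for the leftmost and for the rightmost neighbour as \<open>b\<close>.
\<close>

lemma level_card:
  assumes u: "u \<in> Y" and b: "b \<in> nbrs u" and \<sigma>: "\<bar>\<sigma>\<bar> = 1"
  shows "real (card {v \<in> nbrs u. \<lfloor>\<sigma> * cross2 (b - u) (v - u) / h\<rfloor> = m}) \<le> 34"
proof -
  let ?S = "{v \<in> nbrs u. \<lfloor>\<sigma> * cross2 (b - u) (v - u) / h\<rfloor> = m}"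
  let ?g = "\<lambda>v. \<lfloor>norm (v - u) / h\<rfloor>"
  have "inj_on ?g ?S"
  proof (rule inj_onI, rule ccontr)
    fix v w assume vw: "v \<in> ?S" "w \<in> ?S" "?g v = ?g w" "v \<noteq> w"
    have "\<bar>\<sigma> * cross2 (b - u) (v - u) - \<sigma> * cross2 (b - u) (w - u)\<bar> < h"
      using vw by (intro floor_eq_imp_close h_pos) auto
    then have "\<bar>\<sigma>\<bar> * \<bar>cross2 (b - u) (v - u) - cross2 (b - u) (w - u)\<bar> < h"
      by (simp only: abs_mult[symmetric] right_diff_distrib)
    moreover have "\<bar>norm (v - u) - norm (w - u)\<bar> < h"
      using vw by (intro floor_eq_imp_close h_pos) auto
    ultimately have "norm ((v - u) - (w - u)) < 8 * h"
      using vw u b h_pos \<sigma> nbrs_norm[OF u] nbrs_dot[OF u b]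
      by (intro level_separation[where b = "b - u"]) auto
    then show False using vw separated[of v w] by (auto simp: nbrs_def)
  qed
  then have "card ?S = card (?g ` ?S)" by (simp add: card_image)
  moreover have "real (card (?g ` ?S)) \<le> (1 - (1 - 32 * h)) / h + 2"
    using h_pos nbrs_norm[OF u] by (intro card_floor_range) auto
  ultimately show ?thesis using h_pos by simp
qed

lemma degree_le_width:
  assumes u: "u \<in> Y" and b: "b \<in> nbrs u"
    and B: "\<And>v. v \<in> nbrs u \<Longrightarrow> \<bar>cross2 (b - u) (v - u)\<bar> \<le> B"
  shows "real (card (nbrs u)) \<le> 34 * (2 * B / h + 2)"
proof -
  let ?k = "\<lambda>v. \<lfloor>1 * cross2 (b - u) (v - u) / h\<rfloor>"
  have B0: "0 \<le> B" using B[OF b] by linarith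
  have "nbrs u = (\<Union>m\<in>?k ` nbrs u. {v \<in> nbrs u. ?k v = m})" by auto
  then have "card (nbrs u) \<le> (\<Sum>m\<in>?k ` nbrs u. card {v \<in> nbrs u. ?k v = m})"
    using card_UN_le[of "?k ` nbrs u" "\<lambda>m. {v \<in> nbrs u. ?k v = m}"] by simp
  then have "real (card (nbrs u)) \<le> (\<Sum>m\<in>?k ` nbrs u. real (card {v \<in> nbrs u. ?k v = m}))"
    by (simp only: of_nat_sum[symmetric] of_nat_le_iff)
  also have "\<dots> \<le> (\<Sum>m\<in>?k ` nbrs u. 34)"
    using level_card[OF u b, of 1] by (intro sum_mono) simp
  also have "\<dots> = 34 * real (card (?k ` nbrs u))" by simp
  also have "real (card (?k ` nbrs u)) \<le> (B - (- B)) / h + 2"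
    using h_pos B0 B by (intro card_floor_range) (auto simp: abs_le_iff minus_le_iff)
  finally show ?thesis by simp
qed

text \<open>
  If \<open>v\<close> lies strictly between \<open>p\<close> and \<open>q\<close> as seen from \<open>u\<close>, then \<open>almost_crossing\<close> with
  \<open>p\<close> bounds how far an edge at \<open>v\<close> can turn away from \<open>u\<close> to one side, and with \<open>q\<close> how far
  it can turn to the other side.
\<close>

lemma degree_le_interior:
  assumes u: "u \<in> Y" and v: "v \<in> nbrs u" and p: "p \<in> nbrs u" and q: "q \<in> nbrs u"
    and a: "0 < a" "a \<le> cross2 (v - u) (p - u)" "a \<le> cross2 (q - u) (v - u)"
  shows "real (card (nbrs v)) \<le> 34 * (576 / a + 2)"
proof -
  have vY: "v \<in> Y" using v by (rule nbrs_in_Y)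
  have "\<bar>cross2 (u - v) (s - v)\<bar> \<le> 288 * h / a" if s: "s \<in> nbrs v" for s
  proof -
    define c where "c = cross2 (v - u) (s - v)"
    have ac: "- (288 * h) \<le> c * cross2 (v - u) (x - u)" if x: "x \<in> nbrs u" for x
    proof -
      have "norm ((v - u) + (s - v) - (x - u)) \<le> 1"
        using diam[of s x] s x by (simp add: nbrs_def)
      then have "- 9 * (32 * h) \<le> cross2 (v - u) (s - v) * cross2 (v - u) (x - u)"
        using nbrs_norm[OF u v] nbrs_norm[OF vY s] nbrs_norm[OF u x]
        by (intro almost_crossing) auto
      then show ?thesis by (simp add: c_def)
    qed
    have "a * \<bar>c\<bar> \<le> 288 * h"
    proof (cases "0 \<le> c")
      case True
      have "c * a \<le> c * cross2 (q - u) (v - u)" using True a by (intro mult_left_mono) auto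
      also have "\<dots> \<le> 288 * h" using ac[OF q] cross2_swap[of "q - u" "v - u"] by simp
      finally show ?thesis using True by (simp add: mult.commute)
    next
      case False
      have "(- c) * a \<le> (- c) * cross2 (v - u) (p - u)" using False a by (intro mult_left_mono) auto
      also have "\<dots> \<le> 288 * h" using ac[OF p] by simp
      finally show ?thesis using False by (simp add: mult.commute)
    qed
    then have "\<bar>c\<bar> \<le> 288 * h / a" using a by (simp add: le_divide_eq mult.commute)
    moreover have "cross2 (u - v) (s - v) = - c"
      using cross2_minus[of "v - u" "s - v"] by (simp add: c_def)
    ultimately show ?thesis by simp
  qed
  then have "real (card (nbrs v)) \<le> 34 * (2 * (288 * h / a) / h + 2)"
    by (rule degree_le_width[OF vY nbrs_sym[OF u v]])
  then show ?thesis using h_pos by simp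
qed

text \<open>
  As \<open>t\<close> one can take the tangent of the angle with a fixed neighbour; all neighbours are
  on one side of the line orthogonal to it, so no tangent jumps.
\<close>

lemma angular_order:
  assumes u: "u \<in> Y"
  obtains t :: "real^2 \<Rightarrow> real"
  where "\<And>v p. v \<in> nbrs u \<Longrightarrow> p \<in> nbrs u \<Longrightarrow> t v \<le> t p \<Longrightarrow> 0 \<le> cross2 (v - u) (p - u)"
proof (cases "nbrs u = {}")
  case False
  then obtain b where b: "b \<in> nbrs u" by auto
  define t where "t v = cross2 (b - u) (v - u) / ((b - u) \<bullet> (v - u))" for v
  have "0 \<le> cross2 (v - u) (p - u)" if v: "v \<in> nbrs u" and p: "p \<in> nbrs u" and "t v \<le> t p" for v p
  proof -
    define V where "V = (b - u) \<bullet> (v - u)"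
    define P where "P = (b - u) \<bullet> (p - u)"
    have VP: "0 < V" "0 < P" using nbrs_dot[OF u b v] nbrs_dot[OF u b p] by (auto simp: V_def P_def)
    have "0 \<le> (t p - t v) * (V * P)" using VP that by simp
    also have "\<dots> = V * cross2 (b - u) (p - u) - cross2 (b - u) (v - u) * P"
      using VP by (simp add: t_def V_def[symmetric] P_def[symmetric] field_simps)
    also have "\<dots> = (norm (b - u))\<^sup>2 * cross2 (v - u) (p - u)"
      unfolding V_def P_def power2_norm_eq_inner inner2 cross2_def
      by (simp add: algebra_simps)
    finally have "0 \<le> (norm (b - u))\<^sup>2 * cross2 (v - u) (p - u)" .
    moreover have "0 < (norm (b - u))\<^sup>2" using nbrs_norm(2)[OF u b] by (intro zero_less_power) linarith
    ultimately show ?thesis using zero_le_mult_iff[of "(norm (b - u))\<^sup>2"] by (metis not_less)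
  qed
  then show ?thesis by (rule that)
qed (use that in auto)

lemma extreme_neighbours:
  assumes u: "u \<in> Y" and ne: "nbrs u \<noteq> {}"
  obtains p q where "p \<in> nbrs u" "q \<in> nbrs u"
    "\<And>v. v \<in> nbrs u \<Longrightarrow> 0 \<le> cross2 (v - u) (p - u)"
    "\<And>v. v \<in> nbrs u \<Longrightarrow> 0 \<le> cross2 (q - u) (v - u)"
proof -
  obtain t :: "real^2 \<Rightarrow> real" where
    t: "\<And>v p. v \<in> nbrs u \<Longrightarrow> p \<in> nbrs u \<Longrightarrow> t v \<le> t p \<Longrightarrow> 0 \<le> cross2 (v - u) (p - u)"
    by (rule angular_order[OF u]) blast
  have im: "finite (t ` nbrs u)" "t ` nbrs u \<noteq> {}" using ne by auto
  obtain p where p: "p \<in> nbrs u" "t p = Max (t ` nbrs u)" using Max_in[OF im] by auto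
  obtain q where q: "q \<in> nbrs u" "t q = Min (t ` nbrs u)" using Min_in[OF im] by auto
  show ?thesis
    using p q t im by (intro that[of p q]) auto
qed

text \<open>
  The bound of \<open>degree_le_interior\<close>, with \<open>a = k * h\<close>. For \<open>k = 0\<close> it degenerates, but then
  the bound on the degree that holds at every vertex, of order \<open>1 / h\<close>, is good enough.
\<close>

lemma degree_le_rank:
  assumes u: "u \<in> Y" and v: "v \<in> nbrs u" and p: "p \<in> nbrs u" and q: "q \<in> nbrs u"
    and k: "real k * h \<le> cross2 (v - u) (p - u)" "real k * h \<le> cross2 (q - u) (v - u)"
  shows "real (card (nbrs v)) \<le> 40000 / (h * real (Suc k))"
proof (cases "k = 0")
  case True
  have vY: "v \<in> Y" using v by (rule nbrs_in_Y)
  have uv: "u \<in> nbrs v" by (rule nbrs_sym[OF u v])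
  have "real (card (nbrs v)) \<le> 34 * (2 * 1 / h + 2)"
    using nbrs_norm[OF vY] uv by (intro degree_le_width[OF vY uv] abs_cross2_le_1) auto
  also have "\<dots> \<le> 40000 / h" using h_pos h_small by (simp add: field_simps)
  finally show ?thesis using True by simp
next
  case False
  define a where "a = real k * h"
  have a: "0 < a" using False h_pos by (simp add: a_def)
  have "a \<le> 1"
    using k(1) abs_cross2_le_1[of "v - u" "p - u"] nbrs_norm[OF u v] nbrs_norm[OF u p]
    unfolding a_def by linarith
  have "real (card (nbrs v)) \<le> 34 * (576 / a + 2)"
    using a k by (intro degree_le_interior[OF u v p q]) (auto simp: a_def)
  also have "\<dots> \<le> 34 * (578 / a)" using a \<open>a \<le> 1\<close> by (simp add: field_simps)
  also have "h * real (Suc k) \<le> h * (2 * real k)"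
    using False h_pos by (intro mult_left_mono) auto
  then have "2 / (2 * a) \<le> 2 / (h * real (Suc k))"
    using a h_pos by (intro divide_left_mono) (auto simp: a_def mult_ac)
  then have "34 * (578 / a) \<le> 39304 / (h * real (Suc k))" by (simp add: field_simps)
  also have "\<dots> \<le> 40000 / (h * real (Suc k))" using h_pos by (intro divide_right_mono) auto
  finally show ?thesis .
qed

text \<open>
  With \<open>p\<close> and \<open>q\<close> the two extreme neighbours of \<open>u\<close> in angular order, \<open>k1 v\<close> and \<open>k2 v\<close>
  measure in units of \<open>h\<close> how far \<open>v\<close> is from either end. The degree of \<open>v\<close> is controlled by
  the smaller of them, hence its root by the sum of the two contributions, and each of these
  sums up by \<open>sum_inverse_sqrt_fibres\<close>.
\<close>

lemma sum_sqrt_degree_le: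
  assumes u: "u \<in> Y"
  shows "(\<Sum>v\<in>nbrs u. sqrt (real (card (nbrs v)))) \<le> 27600 / sqrt h * sqrt (real (card (nbrs u)))"
proof (cases "nbrs u = {}")
  case False
  obtain p q where p: "p \<in> nbrs u" and q: "q \<in> nbrs u"
    and p0: "\<And>v. v \<in> nbrs u \<Longrightarrow> 0 \<le> cross2 (v - u) (p - u)"
    and q0: "\<And>v. v \<in> nbrs u \<Longrightarrow> 0 \<le> cross2 (q - u) (v - u)"
    by (rule extreme_neighbours[OF u False]) blast
  define k1 where "k1 v = nat \<lfloor>cross2 (v - u) (p - u) / h\<rfloor>" for v
  define k2 where "k2 v = nat \<lfloor>cross2 (q - u) (v - u) / h\<rfloor>" for v
  define g where "g k = 1 / sqrt (real (Suc k))" for k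
  have fib1: "real (card {v \<in> nbrs u. k1 v = m}) \<le> 34" for m
  proof -
    have "{v \<in> nbrs u. k1 v = m}
        \<subseteq> {v \<in> nbrs u. \<lfloor>(-1) * cross2 (p - u) (v - u) / h\<rfloor> = int m}"
      using p0 h_pos by (auto simp: k1_def cross2_swap[of "p - u"] nat_eq_iff)
    then have "card {v \<in> nbrs u. k1 v = m}
        \<le> card {v \<in> nbrs u. \<lfloor>(-1) * cross2 (p - u) (v - u) / h\<rfloor> = int m}"
      by (intro card_mono) auto
    with level_card[OF u p, of "-1" "int m"] show ?thesis by simp
  qed
  have fib2: "real (card {v \<in> nbrs u. k2 v = m}) \<le> 34" for m
  proof -
    have "{v \<in> nbrs u. k2 v = m}
        \<subseteq> {v \<in> nbrs u. \<lfloor>1 * cross2 (q - u) (v - u) / h\<rfloor> = int m}"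
      using q0 h_pos by (auto simp: k2_def nat_eq_iff)
    then have "card {v \<in> nbrs u. k2 v = m}
        \<le> card {v \<in> nbrs u. \<lfloor>1 * cross2 (q - u) (v - u) / h\<rfloor> = int m}"
      by (intro card_mono) auto
    with level_card[OF u q, of 1 "int m"] show ?thesis by simp
  qed
  have deg: "sqrt (real (card (nbrs v))) \<le> 200 / sqrt h * (g (k1 v) + g (k2 v))"
    if v: "v \<in> nbrs u" for v
  proof -
    define k where "k = min (k1 v) (k2 v)"
    have "real (k1 v) \<le> cross2 (v - u) (p - u) / h" "real (k2 v) \<le> cross2 (q - u) (v - u) / h"
      using p0[OF v] q0[OF v] h_pos by (simp_all add: k1_def k2_def)
    then have "real k \<le> cross2 (v - u) (p - u) / h" "real k \<le> cross2 (q - u) (v - u) / h"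
      by (simp_all add: k_def)
    then have "real (card (nbrs v)) \<le> 40000 / (h * real (Suc k))"
      using h_pos by (intro degree_le_rank[OF u v p q]) (simp_all add: le_divide_eq)
    then have "sqrt (real (card (nbrs v))) \<le> sqrt (200\<^sup>2 / (h * real (Suc k)))" by simp
    also have "\<dots> = 200 / sqrt h * g k"
      by (simp only: real_sqrt_divide real_sqrt_mult real_sqrt_abs g_def) simp
    also have "\<dots> \<le> 200 / sqrt h * (g (k1 v) + g (k2 v))"
    proof (intro mult_left_mono)
      have "0 \<le> g m" for m by (simp add: g_def)
      then show "g k \<le> g (k1 v) + g (k2 v)" by (auto simp: k_def min_def)
    qed (use h_pos in auto)
    finally show ?thesis .
  qed
  have "(\<Sum>v\<in>nbrs u. sqrt (real (card (nbrs v))))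
      \<le> (\<Sum>v\<in>nbrs u. 200 / sqrt h * (g (k1 v) + g (k2 v)))"
    by (intro sum_mono deg)
  also have "\<dots> = 200 / sqrt h * ((\<Sum>v\<in>nbrs u. g (k1 v)) + (\<Sum>v\<in>nbrs u. g (k2 v)))"
    by (simp add: sum.distrib distrib_left sum_distrib_left)
  also have "\<dots> \<le> 200 / sqrt h * ((2 * 34 + 1) * sqrt (real (card (nbrs u)))
      + (2 * 34 + 1) * sqrt (real (card (nbrs u))))"
    unfolding g_def using fib1 fib2 h_pos
    by (intro mult_left_mono add_mono sum_inverse_sqrt_fibres) auto
  finally show ?thesis by simp
qed simp

lemma near_unit_graph_form_le:
  "(\<Sum>u\<in>Y. \<Sum>v\<in>nbrs u. w u * w v) \<le> 27600 / sqrt h * (\<Sum>u\<in>Y. (w u)\<^sup>2)"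
proof -
  let ?R = "\<lambda>u v. 1 - 32 * h \<le> norm (v - u)"
  have *: "{v \<in> Y. ?R u v} = nbrs u" for u by (simp add: nbrs_def)
  have "(\<Sum>u\<in>Y. \<Sum>v | v \<in> Y \<and> ?R u v. w u * w v) \<le> 27600 / sqrt h * (\<Sum>u\<in>Y. (w u)\<^sup>2)"
  proof (rule schur_test[where f = "\<lambda>u. sqrt (real (card (nbrs u)))"])
    fix u v assume "u \<in> Y" "v \<in> Y" "?R u v"
    then show "0 < sqrt (real (card (nbrs u)))"
      by (auto simp: card_gt_0_iff nbrs_def[of u] finite_Y)
  next
    fix u assume "u \<in> Y"
    then show "(\<Sum>v | v \<in> Y \<and> ?R u v. sqrt (real (card (nbrs v))))
        \<le> 27600 / sqrt h * sqrt (real (card (nbrs u)))"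
      unfolding * by (rule sum_sqrt_degree_le)
  qed (use finite_Y h_pos in \<open>auto simp: norm_minus_commute\<close>)
  then show ?thesis by (simp only: *)
qed

end

section \<open>From point sets to weighted nets\<close>

lemma separated_net_exists:
  fixes X :: "'a::real_normed_vector set"
  assumes "finite X" "0 < r"
  obtains Y where "Y \<subseteq> X" "\<And>x y. x \<in> Y \<Longrightarrow> y \<in> Y \<Longrightarrow> x \<noteq> y \<Longrightarrow> r \<le> norm (x - y)"
    "\<And>x. x \<in> X \<Longrightarrow> \<exists>y\<in>Y. norm (x - y) < r"
proof -
  have "\<exists>Y\<subseteq>X. (\<forall>x\<in>Y. \<forall>y\<in>Y. x \<noteq> y \<longrightarrow> r \<le> norm (x - y)) \<and> (\<forall>x\<in>X. \<exists>y\<in>Y. norm (x - y) < r)"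
    using assms(1)
  proof (induction X)
    case (insert a X)
    then obtain Y where Y: "Y \<subseteq> X" "\<forall>x\<in>Y. \<forall>y\<in>Y. x \<noteq> y \<longrightarrow> r \<le> norm (x - y)"
      "\<forall>x\<in>X. \<exists>y\<in>Y. norm (x - y) < r" by blast
    show ?case
    proof (cases "\<exists>y\<in>Y. norm (a - y) < r")
      case True
      with Y show ?thesis by (intro exI[of _ Y]) auto
    next
      case False
      with Y assms(2) show ?thesis
        by (intro exI[of _ "insert a Y"]) (auto simp: not_less norm_minus_commute)
    qed
  qed auto
  then obtain Y where Y: "Y \<subseteq> X" "\<forall>x\<in>Y. \<forall>y\<in>Y. x \<noteq> y \<longrightarrow> r \<le> norm (x - y)"
    "\<forall>x\<in>X. \<exists>y\<in>Y. norm (x - y) < r" by auto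
  show ?thesis by (rule that[of Y]) (use Y in auto)
qed

text \<open>
  Rounding both coordinates to multiples of \<open>r / 2\<close> is injective on \<open>Y\<close>, as a square of that
  side has diameter below \<open>r\<close>.
\<close>

lemma card_separated_le:
  fixes Y :: "(real^2) set"
  assumes fin: "finite Y" and r: "0 < r"
    and diam: "\<And>x y. x \<in> Y \<Longrightarrow> y \<in> Y \<Longrightarrow> norm (x - y) \<le> 1"
    and sep: "\<And>x y. x \<in> Y \<Longrightarrow> y \<in> Y \<Longrightarrow> x \<noteq> y \<Longrightarrow> r \<le> norm (x - y)"
  shows "real (card Y) \<le> (4 / r + 2)\<^sup>2"
proof (cases "Y = {}")
  case False
  then obtain a where a: "a \<in> Y" by auto
  define c where "c i y = \<lfloor>(y $ i) / (r / 2)\<rfloor>" for i :: 2 and y :: "real^2"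
  have "inj_on (\<lambda>y. (c 1 y, c 2 y)) Y"
  proof (rule inj_onI, rule ccontr)
    fix x y assume xy: "x \<in> Y" "y \<in> Y" "(c 1 x, c 2 x) = (c 1 y, c 2 y)" "x \<noteq> y"
    have "\<bar>x $ i - y $ i\<bar> < r / 2" if "c i x = c i y" for i
      using that r unfolding c_def by (intro floor_eq_imp_close) auto
    then have "\<bar>x $ 1 - y $ 1\<bar> < r / 2" "\<bar>x $ 2 - y $ 2\<bar> < r / 2" using xy by auto
    moreover have "norm (x - y) \<le> \<bar>x $ 1 - y $ 1\<bar> + \<bar>x $ 2 - y $ 2\<bar>"
      using norm_le_l1_cart[of "x - y"] by (simp add: sum_2)
    ultimately have "norm (x - y) < r" by linarith
    with sep[of x y] xy show False by auto
  qed
  then have "card Y = card ((\<lambda>y. (c 1 y, c 2 y)) ` Y)" by (simp add: card_image)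
  also have "\<dots> \<le> card (c 1 ` Y \<times> c 2 ` Y)" using fin by (intro card_mono) auto
  finally have "real (card Y) \<le> real (card (c 1 ` Y)) * real (card (c 2 ` Y))"
    by (simp add: card_cartesian_product flip: of_nat_mult)
  moreover have C: "real (card (c i ` Y)) \<le> 4 / r + 2" for i
  proof -
    have "a $ i - 1 \<le> y $ i \<and> y $ i \<le> a $ i + 1" if "y \<in> Y" for y
      using component_le_norm_cart[of "y - a" i] diam[OF that a] by auto
    then have "real (card (c i ` Y)) \<le> ((a $ i + 1) - (a $ i - 1)) / (r / 2) + 2"
      unfolding c_def using fin r by (intro card_floor_range) auto
    then show ?thesis by simp
  qed
  ultimately show ?thesis
    unfolding power2_eq_square
    using mult_mono[OF C[of 1] C[of 2]] r by simp
qed (use r in simp)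

text \<open>
  A class with \<open>m\<close> elements contains \<open>m * (m - 1) / 2\<close> pairs, all of them \<open>\<epsilon>\<close>-neighbouring,
  and \<open>m\<^sup>2 = m + 2 * (m * (m - 1) / 2)\<close>.
\<close>

lemma sum_class_squares_le:
  fixes X :: "(real^2) set"
  assumes X: "finite X" and fY: "f ` X \<subseteq> Y" "finite Y"
    and near: "\<And>x y. x \<in> X \<Longrightarrow> y \<in> X \<Longrightarrow> f x = f y \<Longrightarrow> norm (x - y) \<le> \<epsilon>"
  shows "(\<Sum>u\<in>Y. (real (card {x\<in>X. f x = u}))\<^sup>2)
      \<le> real (card X) + 2 * real (card (neighboring_pairs \<epsilon> X))"
proof -
  define c where "c u = {x\<in>X. f x = u}" for u
  define P where "P u = {B. B \<subseteq> c u \<and> card B = 2}" for u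
  have fc: "finite (c u)" for u using X by (simp add: c_def)
  have fP: "finite (P u)" for u by (rule finite_subset[of _ "Pow (c u)"]) (auto simp: P_def fc)
  have sq: "(real (card (c u)))\<^sup>2 = real (card (c u)) + 2 * real (card (P u))" for u
  proof -
    have "card (P u) = card (c u) choose 2" unfolding P_def by (rule n_subsets[OF fc])
    moreover have "real (m choose 2) = real m * (real m - 1) / 2" for m
      by (induction m) (auto simp: numeral_2_eq_2 field_simps)
    ultimately have "real (card (P u)) = real (card (c u)) * (real (card (c u)) - 1) / 2"
      by simp
    then show ?thesis by (simp add: power2_eq_square algebra_simps)
  qed
  have fN: "finite (neighboring_pairs \<epsilon> X)"
    by (rule finite_subset[of _ "Pow X"]) (auto simp: neighboring_pairs_def X)
  have "(\<Sum>u\<in>Y. card (P u)) = card (\<Union>u\<in>Y. P u)"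
  proof (rule card_UN_disjoint[symmetric])
    show "\<forall>i\<in>Y. \<forall>j\<in>Y. i \<noteq> j \<longrightarrow> P i \<inter> P j = {}"
      by (auto simp: P_def c_def card_2_iff)
  qed (use fY fP in auto)
  also have "\<dots> \<le> card (neighboring_pairs \<epsilon> X)"
  proof (intro card_mono fN subsetI)
    fix B assume "B \<in> (\<Union>u\<in>Y. P u)"
    then obtain u x y where "B = {x, y}" "x \<noteq> y" "x \<in> X" "y \<in> X" "f x = u" "f y = u"
      by (auto simp: P_def c_def card_2_iff)
    then show "B \<in> neighboring_pairs \<epsilon> X" using near[of x y] by (auto simp: neighboring_pairs_def)
  qed
  finally have pairs: "(\<Sum>u\<in>Y. real (card (P u))) \<le> real (card (neighboring_pairs \<epsilon> X))"
    by (simp flip: of_nat_sum)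
  have "(\<Sum>u\<in>Y. card (c u)) = card X"
    using X fY sum.group[of X Y f "\<lambda>_. 1::nat"] by (simp add: c_def)
  then have "(\<Sum>u\<in>Y. real (card (c u))) = real (card X)" by (simp flip: of_nat_sum)
  then have "(\<Sum>u\<in>Y. (real (card (c u)))\<^sup>2) = real (card X) + 2 * (\<Sum>u\<in>Y. real (card (P u)))"
    by (simp add: sq sum.distrib sum_distrib_left)
  with pairs show ?thesis by (simp add: c_def)
qed

lemma card_antipodal_pairs_le:
  assumes X: "finite X" and fY: "f ` X \<subseteq> Y" "finite Y"
    and N: "\<And>x y. x \<in> X \<Longrightarrow> y \<in> X \<Longrightarrow> 1 - \<epsilon> \<le> norm (x - y) \<Longrightarrow> f y \<in> N (f x)"
    and NY: "\<And>u. N u \<subseteq> Y"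
  shows "real (card (antipodal_pairs \<epsilon> X))
      \<le> (\<Sum>u\<in>Y. \<Sum>v\<in>N u. real (card {x\<in>X. f x = u}) * real (card {x\<in>X. f x = v}))"
proof -
  define c where "c u = {x\<in>X. f x = u}" for u
  have fc: "finite (c u)" for u using X by (simp add: c_def)
  have fN: "finite (N u)" for u using NY fY finite_subset by blast
  define P where "P = (\<Union>u\<in>Y. \<Union>v\<in>N u. c u \<times> c v)"
  have fP: "finite P" using fY fN fc by (auto simp: P_def)
  have "antipodal_pairs \<epsilon> X \<subseteq> (\<lambda>(x, y). {x, y}) ` P"
  proof
    fix B assume "B \<in> antipodal_pairs \<epsilon> X"
    then obtain x y where B: "B = {x, y}" "x \<in> X" "y \<in> X" "1 - \<epsilon> \<le> norm (x - y)"
      by (auto simp: antipodal_pairs_def)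
    then have "(x, y) \<in> P" using N[of x y] fY by (auto simp: P_def c_def)
    then show "B \<in> (\<lambda>(x, y). {x, y}) ` P" using B by force
  qed
  then have "card (antipodal_pairs \<epsilon> X) \<le> card P"
    by (rule surj_card_le[OF fP])
  also have "\<dots> \<le> (\<Sum>u\<in>Y. card (\<Union>v\<in>N u. c u \<times> c v))"
    unfolding P_def by (rule card_UN_le[OF fY(2)])
  also have "\<dots> \<le> (\<Sum>u\<in>Y. \<Sum>v\<in>N u. card (c u \<times> c v))"
    by (intro sum_mono card_UN_le fN)
  finally have "real (card (antipodal_pairs \<epsilon> X)) \<le> real (\<Sum>u\<in>Y. \<Sum>v\<in>N u. card (c u \<times> c v))"
    by (simp only: of_nat_le_iff)
  then show ?thesis by (simp add: c_def card_cartesian_product)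
qed

lemma neighboring_pairs_bound:
  fixes X :: "(real^2) set" and \<epsilon> :: real
  assumes \<epsilon>: "0 < \<epsilon>" "\<epsilon> < 1" and X: "finite X" "diameter X \<le> 1"
    and large: "200 / \<epsilon>\<^sup>2 \<le> real (card X)"
  shows "sqrt \<epsilon> * real (card (antipodal_pairs \<epsilon> X))
      \<le> 16000000 * real (card (neighboring_pairs \<epsilon> X))"
proof -
  define n where "n = real (card X)"
  define N where "N = real (card (neighboring_pairs \<epsilon> X))"
  define A where "A = real (card (antipodal_pairs \<epsilon> X))"
  have diam: "norm (x - y) \<le> 1" if "x \<in> X" "y \<in> X" for x y
    using diameter_bounded_bound[OF finite_imp_bounded[OF X(1)] that] X(2)
    by (simp add: dist_norm)
  obtain Y where Y: "Y \<subseteq> X" "\<And>x y. x \<in> Y \<Longrightarrow> y \<in> Y \<Longrightarrow> x \<noteq> y \<Longrightarrow> \<epsilon> / 2 \<le> norm (x - y)"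
    "\<And>x. x \<in> X \<Longrightarrow> \<exists>y\<in>Y. norm (x - y) < \<epsilon> / 2"
    using separated_net_exists[OF X(1), of "\<epsilon> / 2"] \<epsilon> by auto
  have finY: "finite Y" using Y X finite_subset by blast
  from Y(3) obtain f where f: "\<And>x. x \<in> X \<Longrightarrow> f x \<in> Y" "\<And>x. x \<in> X \<Longrightarrow> norm (x - f x) < \<epsilon> / 2"
    by metis
  define w where "w u = real (card {x\<in>X. f x = u})" for u
  define W where "W = (\<Sum>u\<in>Y. (w u)\<^sup>2)"
  have fY: "f ` X \<subseteq> Y" using f by auto
  have near: "norm (x - y) \<le> \<epsilon>" if "x \<in> X" "y \<in> X" "f x = f y" for x y
    using f(2)[of x] f(2)[of y] that norm_triangle_ineq4[of "x - f x" "y - f x"] by simp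
  \<comment> \<open>The number of points is absorbed: the pigeonhole principle forces \<open>2 * n \<le> W\<close>, so that
      at least half of \<open>W\<close> comes from neighbouring pairs.\<close>
  have W1: "W \<le> n + 2 * N"
    unfolding W_def w_def n_def N_def
    by (rule sum_class_squares_le[OF X(1) fY finY]) (rule near)
  have "real (card Y) \<le> (4 / (\<epsilon> / 2) + 2)\<^sup>2"
    using Y(2) subsetD[OF Y(1)] \<epsilon> diam by (intro card_separated_le finY) auto
  also have "\<dots> \<le> (10 / \<epsilon>)\<^sup>2"
    using \<epsilon> by (intro power_mono) (auto simp: field_simps)
  finally have cY: "real (card Y) \<le> 100 / \<epsilon>\<^sup>2" by (simp add: power_divide)
  have "(\<Sum>u\<in>Y. card {x\<in>X. f x = u}) = card X"
    using X finY fY sum.group[of X Y f "\<lambda>_. 1::nat"] by simp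
  then have n_eq: "(\<Sum>u\<in>Y. w u) = n" by (simp add: w_def n_def flip: of_nat_sum)
  have W0: "0 \<le> W" by (simp add: W_def sum_nonneg)
  have "n\<^sup>2 \<le> W * real (card Y)"
    using sum_squared_le_sum_of_squares[of w Y] by (simp add: n_eq W_def mult.commute)
  also have "\<dots> \<le> W * (100 / \<epsilon>\<^sup>2)" using W0 cY by (intro mult_left_mono)
  finally have n2: "n\<^sup>2 \<le> 100 / \<epsilon>\<^sup>2 * W" by (simp add: mult.commute)
  have npos: "0 < n" using large \<epsilon> unfolding n_def
    by (smt (verit) divide_pos_pos zero_less_power)
  have "n * (200 / \<epsilon>\<^sup>2) \<le> n\<^sup>2"
    using large npos by (simp only: power2_eq_square n_def[symmetric]) (intro mult_left_mono, auto)
  then have "2 * n \<le> W" using n2 \<epsilon> by (simp add: field_simps)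
  then have W4: "W \<le> 4 * N" using W1 by linarith
  show ?thesis
  proof (cases "\<epsilon> \<le> 1/200")
    case True
    interpret near_unit_graph Y "\<epsilon> / 16"
      using finY \<epsilon> True diam Y(2) subsetD[OF Y(1)] by unfold_locales auto
    have adj: "f y \<in> nbrs (f x)" if "x \<in> X" "y \<in> X" "1 - \<epsilon> \<le> norm (x - y)" for x y
    proof -
      have "x - y = (x - f x) + (f x - f y) + (f y - y)" by simp
      then have "norm (x - y) \<le> norm (x - f x) + norm (f x - f y) + norm (f y - y)"
        using norm_triangle_ineq[of "(x - f x) + (f x - f y)" "f y - y"]
          norm_triangle_ineq[of "x - f x" "f x - f y"] by simp
      then show ?thesis
        using that f(2)[of x] f(2)[of y] f(1)[of y]
        by (simp add: nbrs_def norm_minus_commute)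
    qed
    have "A \<le> (\<Sum>u\<in>Y. \<Sum>v\<in>nbrs u. w u * w v)"
      unfolding A_def w_def
      by (rule card_antipodal_pairs_le[OF X(1) fY finY]) (use adj in \<open>auto simp: nbrs_def\<close>)
    also have "\<dots> \<le> 27600 / sqrt (\<epsilon> / 16) * W"
      unfolding W_def by (rule near_unit_graph_form_le)
    also have "sqrt (\<epsilon> / 16) = sqrt \<epsilon> / 4" by (simp add: real_sqrt_divide)
    finally have "sqrt \<epsilon> * A \<le> 110400 * W" using \<epsilon> by (simp add: field_simps)
    also have "\<dots> \<le> 16000000 * N" using W4 by (simp add: N_def)
    finally show ?thesis by (simp add: A_def N_def)
  next
    case False
    have "antipodal_pairs \<epsilon> X \<subseteq> (\<lambda>(x, y). {x, y}) ` (X \<times> X)"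
      by (auto simp: antipodal_pairs_def)
    then have "card (antipodal_pairs \<epsilon> X) \<le> card (X \<times> X)"
      by (rule surj_card_le[OF finite_cartesian_product[OF X(1) X(1)]])
    then have "A \<le> n\<^sup>2"
      by (simp add: A_def n_def card_cartesian_product power2_eq_square flip: of_nat_mult)
    also have "\<dots> \<le> 100 / \<epsilon>\<^sup>2 * W" by (rule n2)
    also have "\<dots> \<le> 100 / (1/200)\<^sup>2 * W"
      using False W0 \<epsilon> by (intro mult_right_mono divide_left_mono power_mono) auto
    finally have "A \<le> 16000000 * N" using W4 by (simp add: power2_eq_square)
    moreover have "sqrt \<epsilon> * A \<le> 1 * A"
      using \<epsilon> by (intro mult_right_mono) (auto simp: A_def)
    ultimately show ?thesis by (simp add: A_def N_def)
  qed
qed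

theorem theorem1p3:
  shows "\<exists>c1 c2 :: real. c1 > 0 \<and> c2 > 0 \<and>
    (\<forall>(\<epsilon>::real) (X :: (real^2) set).
       0 < \<epsilon> \<longrightarrow> \<epsilon> < 1 \<longrightarrow> finite X \<longrightarrow> diameter X \<le> 1 \<longrightarrow>
       real (card X) \<ge> c1 * \<epsilon> powr (-2) \<longrightarrow>
       real (card (neighboring_pairs \<epsilon> X))
         \<ge> c2 * \<epsilon> powr (1/2) * real (card (antipodal_pairs \<epsilon> X)))"
proof (intro exI conjI allI impI)
  fix \<epsilon> :: real and X :: "(real^2) set"
  assume \<epsilon>: "0 < \<epsilon>" "\<epsilon> < 1" and X: "finite X" "diameter X \<le> 1"
    and large: "200 * \<epsilon> powr (-2) \<le> real (card X)"
  have "\<epsilon> powr (-2) = 1 / \<epsilon>\<^sup>2" using \<epsilon> by (simp add: powr_minus_divide)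
  then have "sqrt \<epsilon> * real (card (antipodal_pairs \<epsilon> X))
      \<le> 16000000 * real (card (neighboring_pairs \<epsilon> X))"
    using large by (intro neighboring_pairs_bound \<epsilon> X) simp
  then show "1/16000000 * \<epsilon> powr (1/2) * real (card (antipodal_pairs \<epsilon> X))
      \<le> real (card (neighboring_pairs \<epsilon> X))"
    using \<epsilon> by (simp add: powr_half_sqrt)
qed auto

end
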